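(* For every integer $n\ge 2$, setting $x_n=(-1)^{n+1}\,2P_nP_{n-1}$, the tuple $(1,x_n,1,-1,1,-1)$ is a half-relation for $P_{n+1}/P_n$. For every integer $n\ge 1$, setting $y_n=(-1)^nH_nH_{n-1}$, the tuple $(1,y_n,1,-1,1,-1)$ is a half-relation for $H_{n+1}/H_n$.
   Context: The Pell numbers are defined by $P_0=0$, $P_1=1$, $P_n=2P_{n-1}+P_{n-2}$ for $n\ge 2$. The half-companion Pell numbers are defined by $H_0=1$, $H_1=1$, $H_n=2H_{n-1}+H_{n-2}$ for $n\ge 2$. For $q\in\mathbb{R}$ let $A=\begin{pmatrix}1&1\\0&1\end{pmatrix}$ and $B_q=\begin{pmatrix}1&0\\ q&1\end{pmatrix}$. A tuple $(a_1,\dots,a_6)\in\mathbb{Z}^6$ with all $a_i\neq 0$ is a half-relation for $q$ if the matrix $M=A^{a_1}B_q^{a_2}A^{a_3}B_q^{a_4}A^{a_5}B_q^{a_6}$ satisfies $c_{11}(M)-c_{22}(M)=0$, where $c_{ij}(M)$ is the $(i,j)$ entry of $M$. *)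

theory Defs
  imports "HOL-Analysis.Analysis"
begin

fun pell :: "nat \<Rightarrow> int" where
  "pell 0 = 0"
| "pell (Suc 0) = 1"
| "pell (Suc (Suc n)) = 2 * pell (Suc n) + pell n"

fun half_companion_pell :: "nat \<Rightarrow> int" where
  "half_companion_pell 0 = 1"
| "half_companion_pell (Suc 0) = 1"
| "half_companion_pell (Suc (Suc n)) = 2 * half_companion_pell (Suc n) + half_companion_pell n"

(* The library's power on vectors of vectors is componentwise, so integer powers with
   respect to the matrix product are defined here.  For a negative exponent the value is
   meaningful for invertible matrices only. *)
definition matrix_powi :: "real ^ 'n ^ 'n \<Rightarrow> int \<Rightarrow> real ^ 'n ^ 'n" where
  "matrix_powi X k =
     (if 0 \<le> k then (((**) X) ^^ nat k) (mat 1)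
      else (((**) (matrix_inv X)) ^^ nat (- k)) (mat 1))"

definition mat_A :: "real ^ 2 ^ 2" where
  "mat_A = vector [vector [1, 1], vector [0, 1]]"

definition mat_B :: "real \<Rightarrow> real ^ 2 ^ 2" where
  "mat_B q = vector [vector [1, 0], vector [q, 1]]"

fun relation_matrix :: "real \<Rightarrow> int \<times> int \<times> int \<times> int \<times> int \<times> int \<Rightarrow> real ^ 2 ^ 2" where
  "relation_matrix q (a1, a2, a3, a4, a5, a6) =
     matrix_powi mat_A a1 ** matrix_powi (mat_B q) a2 **
     matrix_powi mat_A a3 ** matrix_powi (mat_B q) a4 **
     matrix_powi mat_A a5 ** matrix_powi (mat_B q) a6"

fun half_relation :: "real \<Rightarrow> int \<times> int \<times> int \<times> int \<times> int \<times> int \<Rightarrow> bool" where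
  "half_relation q (a1, a2, a3, a4, a5, a6) \<longleftrightarrow>
     a1 \<noteq> 0 \<and> a2 \<noteq> 0 \<and> a3 \<noteq> 0 \<and> a4 \<noteq> 0 \<and> a5 \<noteq> 0 \<and> a6 \<noteq> 0 \<and>
     (let M = relation_matrix q (a1, a2, a3, a4, a5, a6) in M $ 1 $ 1 - M $ 2 $ 2 = 0)"

end

theory Submission
  imports Defs
begin

text \<open>
  Lower unitriangular matrices multiply by adding their corner entries, so
  \<open>B_q\<^sup>x\<close> has corner entry \<open>x * q\<close>, and the word
  \<open>A B_q\<^sup>x A B_q\<^sup>-\<^sup>1 A B_q\<^sup>-\<^sup>1\<close> can be multiplied out once and for all.  The difference of
  its diagonal entries is \<open>q * (2 * q - 4 + x * (q\<^sup>2 - 2 * q - 1))\<close>.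

  The quadratic \<open>q\<^sup>2 - 2 * q - 1\<close> is the characteristic polynomial of the recurrence
  \<open>u (n + 2) = 2 * u (n + 1) + u n\<close> shared by both sequences.  Therefore, for a ratio
  \<open>q = c / b\<close> of neighbours in consecutive terms \<open>a, b, c\<close> of a solution,
  \<open>2 * q - 4 = 2 * a / b\<close> and \<open>q\<^sup>2 - 2 * q - 1 = (a * c - b\<^sup>2) / b\<^sup>2\<close>, and the
  tuple is a half-relation as soon as \<open>x * (a * c - b\<^sup>2) = - 2 * a * b\<close> with \<open>x \<noteq> 0\<close>.  Cassini's identity
  says that \<open>a * c - b\<^sup>2\<close> is \<open>\<plusminus>1\<close> for the Pell numbers and \<open>\<plusminus>2\<close> for the
  half-companion Pell numbers; this makes \<open>x\<close> an integer and gives the two stated values,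
  which are nonzero because the sequences are positive at the indices involved.
\<close>

lemma mat_B_mult: "mat_B p ** mat_B q = mat_B (p + q)"
  by (simp add: mat_B_def vec_eq_iff forall_2 matrix_matrix_mult_def sum_2)

lemma mat_B_0: "mat_B 0 = mat 1"
  by (simp add: mat_B_def vec_eq_iff forall_2 mat_def)

text \<open>
  \<open>matrix_inv\<close> is an arbitrary choice among two-sided inverses; uniqueness of inverses
  pins it down.
\<close>

lemma matrix_inv_eqI:
  fixes X :: "'a::semiring_1 ^ 'n ^ 'm" and Y :: "'a ^ 'm ^ 'n"
  assumes "X ** Y = mat 1" "Y ** X = mat 1"
  shows "matrix_inv X = Y"
  unfolding matrix_inv_def
  by (rule some_equality)
    (use assms in simp, metis assms(1) matrix_mul_assoc matrix_mul_lid matrix_mul_rid)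

lemma matrix_inv_mat_B: "matrix_inv (mat_B q) = mat_B (- q)"
  by (rule matrix_inv_eqI) (simp_all add: mat_B_mult mat_B_0)

lemma mat_B_funpow: "(((**) (mat_B q)) ^^ k) (mat 1) = mat_B (real k * q)"
  by (induction k) (simp_all add: mat_B_0 mat_B_mult algebra_simps)

lemma matrix_powi_mat_B: "matrix_powi (mat_B q) k = mat_B (of_int k * q)"
  by (simp add: matrix_powi_def mat_B_funpow matrix_inv_mat_B)

lemma matrix_powi_1: "matrix_powi X 1 = X"
  by (simp add: matrix_powi_def)

lemma relation_matrix_diagonal_difference:
  fixes q :: real and x :: int
  defines "M \<equiv> relation_matrix q (1, x, 1, -1, 1, -1)"
  shows "M $ 1 $ 1 - M $ 2 $ 2 = q * (2 * q - 4 + of_int x * (q\<^sup>2 - 2 * q - 1))"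
  unfolding M_def relation_matrix.simps matrix_powi_mat_B matrix_powi_1
  by (simp add: mat_A_def mat_B_def matrix_matrix_mult_def sum_2 algebra_simps power2_eq_square)

text \<open>
  The last premise is \<open>2 * q - 4 + x * (q\<^sup>2 - 2 * q - 1) = 0\<close> for \<open>q = c / b\<close> with the
  denominator \<open>b\<^sup>2\<close> cleared, which keeps it an equation between integers.
\<close>

lemma half_relation_ratio:
  fixes a b c x :: int
  assumes rec: "c = 2 * b + a" and "b \<noteq> 0" "x \<noteq> 0"
    and x: "x * (a * c - b\<^sup>2) = - 2 * a * b"
  shows "half_relation (of_int c / of_int b) (1, x, 1, -1, 1, -1)"
proof -
  define q :: real where "q = of_int c / of_int b"
  have b: "real_of_int b \<noteq> 0" using \<open>b \<noteq> 0\<close> by simp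
  have c: "real_of_int c = q * of_int b" using b by (simp add: q_def)
  have a: "real_of_int a = of_int b * (q - 2)"
    using arg_cong[OF rec, of real_of_int] by (simp add: c algebra_simps)
  have "real_of_int x * (of_int a * of_int c - (of_int b)\<^sup>2) = - 2 * of_int a * of_int b"
    using arg_cong[OF x, of real_of_int] by simp
  then have "(of_int b)\<^sup>2 * (2 * q - 4 + of_int x * (q\<^sup>2 - 2 * q - 1)) = 0"
    unfolding a c by (simp add: algebra_simps power2_eq_square)
  then have "2 * q - 4 + of_int x * (q\<^sup>2 - 2 * q - 1) = 0"
    using b by simp
  then show ?thesis
    using \<open>x \<noteq> 0\<close> relation_matrix_diagonal_difference[of q x]
    by (simp add: q_def[symmetric] Let_def del: relation_matrix.simps)
qed

text \<open>
  Cassini's identity: \<open>u n * u (n + 2) - (u (n + 1))\<^sup>2\<close> is the determinant of the matrix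
  with columns the consecutive states \<open>(u n, u (n + 1))\<close> and \<open>(u (n + 1), u (n + 2))\<close>, and the companion matrix of the recurrence has determinant
  \<open>- 1\<close>.
\<close>

lemma pell_recurrence_cassini:
  fixes u :: "nat \<Rightarrow> int"
  assumes rec: "\<And>n. u (Suc (Suc n)) = 2 * u (Suc n) + u n"
  shows "u n * u (Suc (Suc n)) - (u (Suc n))\<^sup>2 = (-1) ^ n * (u 0 * u 2 - (u 1)\<^sup>2)"
proof (induction n)
  case 0
  show ?case by (simp add: numeral_2_eq_2)
next
  case (Suc n)
  have "u (Suc n) * u (Suc (Suc (Suc n))) - (u (Suc (Suc n)))\<^sup>2
      = - (u n * u (Suc (Suc n)) - (u (Suc n))\<^sup>2)"
    by (simp add: rec algebra_simps power2_eq_square)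
  then show ?case by (simp add: Suc.IH)
qed

lemma pell_cassini: "pell n * pell (Suc (Suc n)) - (pell (Suc n))\<^sup>2 = - ((-1) ^ n)"
  using pell_recurrence_cassini[of pell n] by simp

lemma half_companion_pell_cassini:
  "half_companion_pell n * half_companion_pell (Suc (Suc n)) - (half_companion_pell (Suc n))\<^sup>2
    = 2 * (-1) ^ n"
  using pell_recurrence_cassini[of half_companion_pell n] by (simp add: numeral_2_eq_2)

lemma pell_pos: "0 < pell (Suc n)"
proof (induction n rule: less_induct)
  case (less n)
  show ?case
  proof (cases n)
    case (Suc m)
    then show ?thesis using less[of m] less[of "m - 1"] by (cases m) auto
  qed simp
qed

lemma half_companion_pell_pos: "0 < half_companion_pell n"
  by (induction n rule: half_companion_pell.induct) auto

theorem proposition4p5: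
  shows "(\<forall>n::nat. n \<ge> 2 \<longrightarrow>
            half_relation (real_of_int (pell (n + 1)) / real_of_int (pell n))
              (1, (-1) ^ (n + 1) * 2 * pell n * pell (n - 1), 1, -1, 1, -1))
       \<and> (\<forall>n::nat. n \<ge> 1 \<longrightarrow>
            half_relation (real_of_int (half_companion_pell (n + 1)) / real_of_int (half_companion_pell n))
              (1, (-1) ^ n * half_companion_pell n * half_companion_pell (n - 1), 1, -1, 1, -1))"
proof (intro conjI allI impI)
  fix n :: nat
  assume "n \<ge> 2"
  \<comment> \<open>The Pell numbers are positive only from index \<open>1\<close> on, so the smallest index is
    exposed as a successor.\<close>
  then obtain k where n: "n = Suc (Suc k)"
    by (metis Suc_le_D numeral_2_eq_2 Suc_le_mono)
  let ?x = "(-1) ^ (n + 1) * 2 * pell n * pell (n - 1)"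
  show "half_relation (real_of_int (pell (n + 1)) / real_of_int (pell n)) (1, ?x, 1, -1, 1, -1)"
  proof (rule half_relation_ratio)
    show "pell (n + 1) = 2 * pell n + pell (n - 1)" by (simp add: n)
    show "pell n \<noteq> 0" "?x \<noteq> 0"
      using pell_pos[of k] pell_pos[of "Suc k"] unfolding n by (simp_all del: pell.simps)
    have "pell (n - 1) * pell (n + 1) - (pell n)\<^sup>2 = (-1) ^ n"
      using pell_cassini[of "Suc k"] unfolding n by (simp del: pell.simps)
    then show "?x * (pell (n - 1) * pell (n + 1) - (pell n)\<^sup>2) = - 2 * pell (n - 1) * pell n"
      by (simp add: power_add[symmetric] mult.commute mult.left_commute del: pell.simps)
  qed
next
  fix n :: nat
  assume "n \<ge> 1"
  then obtain k where n: "n = Suc k" by (metis Suc_le_D One_nat_def)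
  let ?h = half_companion_pell
  let ?x = "(-1) ^ n * ?h n * ?h (n - 1)"
  show "half_relation (real_of_int (?h (n + 1)) / real_of_int (?h n)) (1, ?x, 1, -1, 1, -1)"
  proof (rule half_relation_ratio)
    show "?h (n + 1) = 2 * ?h n + ?h (n - 1)" by (simp add: n)
    show "?h n \<noteq> 0" "?x \<noteq> 0"
      using half_companion_pell_pos[of k] half_companion_pell_pos[of "Suc k"]
      unfolding n by (simp_all del: half_companion_pell.simps)
    have "?h (n - 1) * ?h (n + 1) - (?h n)\<^sup>2 = - 2 * (-1) ^ n"
      using half_companion_pell_cassini[of k] unfolding n
      by (simp del: half_companion_pell.simps)
    then show "?x * (?h (n - 1) * ?h (n + 1) - (?h n)\<^sup>2) = - 2 * ?h (n - 1) * ?h n"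
      by (simp add: power_add[symmetric] mult.commute mult.left_commute
          del: half_companion_pell.simps)
  qed
qed

end
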